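(* Let $O=(0,0,0)$. Every equilateral triangle $OAB$ with $A,B\in\mathbb{Z}^3$ lying in the plane $\{(\alpha,\beta,\gamma):\alpha+\beta+\gamma=0\}$ satisfies $\{A,B\}=\{(m,-n,n-m),\,(m-n,-m,n)\}$ for some integers $m,n$, and its side length is $\sqrt{2(m^2-mn+n^2)}$. *)

theory Defs
  imports "HOL-Analysis.Analysis"
begin

definition equilateral_triangle :: "'a::euclidean_space \<Rightarrow> 'a \<Rightarrow> 'a \<Rightarrow> bool" where
  "equilateral_triangle P Q R \<longleftrightarrow>
     \<not> collinear {P, Q, R} \<and> dist P Q = dist Q R \<and> dist Q R = dist R P"

definition integer_points :: "(real ^ 3) set" where
  "integer_points = {x. \<forall>i. x $ i \<in> \<int>}"

definition zero_sum_plane :: "(real ^ 3) set" where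
  "zero_sum_plane = {x. x $ 1 + x $ 2 + x $ 3 = 0}"

end

theory Submission imports Defs
begin

text \<open>
  In a plane, a given side \<open>P Q\<close> belongs to exactly two equilateral triangles, whose third vertices
  \<open>R\<close> and \<open>P + Q - R\<close> are reflections of each other in the midpoint of \<open>P Q\<close>. In the plane
  \<open>x + y + z = 0\<close> the rotation by 60 degrees about the origin is \<open>(x, y, z) \<mapsto> (- z, - x, - y)\<close>, so
  for a triangle with vertices \<open>0, A, B\<close> one of \<open>A\<close>, \<open>B\<close> is the image of the other. Writing the
  rotated vertex as \<open>(m, - n, n - m)\<close> turns its image into \<open>(m - n, - m, n)\<close>.
\<close>

lemma span_sixty_degrees_cases:
  fixes a b c :: "'a::real_inner"
  assumes norms: "norm b = norm a" "norm c = norm a"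
    and inners: "a \<bullet> b = (norm a)\<^sup>2 / 2" "a \<bullet> c = (norm a)\<^sup>2 / 2"
    and "c \<in> span {a, b}"
  obtains "c = b" | "c = a - b"
proof (cases "a = 0")
  case True
  then show ?thesis
    using norms that by simp
next
  case False
  obtain v w where c: "c = v *\<^sub>R a + w *\<^sub>R b"
    using assms(5) by (auto simp: span_breakdown_eq algebra_simps)
  define d where "d = (norm a)\<^sup>2"
  have "d \<noteq> 0"
    using False by (simp add: d_def)
  have products: "a \<bullet> a = d" "b \<bullet> b = d" "c \<bullet> c = d" "a \<bullet> b = d / 2" "b \<bullet> a = d / 2" "a \<bullet> c = d / 2"
    using norms inners by (simp_all add: d_def inner_commute flip: power2_norm_eq_inner)
  have "a \<bullet> c = d * (v + w / 2)"
    unfolding c by (simp add: products inner_add_right algebra_simps)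
  then have v: "v = (1 - w) / 2"
    using products(6) \<open>d \<noteq> 0\<close> by simp
  have "c \<bullet> c = d * (v\<^sup>2 + v * w + w\<^sup>2)"
    unfolding c
    by (simp add: products inner_add_left inner_add_right power2_eq_square algebra_simps)
  then have "v\<^sup>2 + v * w + w\<^sup>2 = 1"
    using products(3) \<open>d \<noteq> 0\<close> by simp
  then have "w\<^sup>2 = 1"
    unfolding v by (simp add: power2_eq_square field_simps)
  then have "w = 1 \<and> v = 0 \<or> w = -1 \<and> v = 1"
    using v by (auto simp: power2_eq_1_iff)
  then show ?thesis
    using that c by auto
qed

lemma equilateral_triangle_iff_dist:
  "equilateral_triangle P Q R \<longleftrightarrow> P \<noteq> Q \<and> dist P Q = dist Q R \<and> dist Q R = dist R P"
proof -
  have "P = Q" if "collinear {P, Q, R}" "dist P Q = dist Q R" "dist Q R = dist R P"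
    using that by (auto simp: collinear_between_cases between dist_commute)
  moreover have "collinear {P, Q, R}" if "P = Q"
    using that by simp
  ultimately show ?thesis
    unfolding equilateral_triangle_def by blast
qed

lemma inner_equilateral_triangle:
  assumes "equilateral_triangle P Q R"
  shows "(Q - P) \<bullet> (R - P) = (dist P Q)\<^sup>2 / 2"
  using assms dot_norm_neg[of "Q - P" "R - P"]
  by (simp add: equilateral_triangle_def dist_norm norm_minus_commute)

lemma equilateral_triangle_third_vertex_affine_hull:
  assumes PQR: "equilateral_triangle P Q R" and PQS: "equilateral_triangle P Q S"
    and "S \<in> affine hull {P, Q, R}"
  shows "S = R \<or> S = P + Q - R"
proof -
  obtain u v w where "u + v + w = 1" and S: "S = u *\<^sub>R P + v *\<^sub>R Q + w *\<^sub>R R"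
    using assms(3) by (auto simp: affine_hull_3)
  then have u: "u = 1 - v - w"
    by simp
  have "S - P = v *\<^sub>R (Q - P) + w *\<^sub>R (R - P)"
    unfolding S u by (simp add: algebra_simps)
  then have span: "S - P \<in> span {Q - P, R - P}"
    by (simp add: span_add span_scale span_base)
  have norms: "norm (R - P) = norm (Q - P)" "norm (S - P) = norm (Q - P)"
    using PQR PQS by (simp_all add: equilateral_triangle_def dist_norm norm_minus_commute)
  have inners: "(Q - P) \<bullet> (R - P) = (norm (Q - P))\<^sup>2 / 2" "(Q - P) \<bullet> (S - P) = (norm (Q - P))\<^sup>2 / 2"
    using PQR PQS by (simp_all add: inner_equilateral_triangle dist_norm norm_minus_commute)
  show ?thesis
    using span_sixty_degrees_cases[OF norms inners span] by (auto simp: algebra_simps)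
qed

lemma equilateral_triangle_third_vertex:
  assumes PQR: "equilateral_triangle P Q R" and PQS: "equilateral_triangle P Q S"
    and U: "affine U" "aff_dim U = 2" "{P, Q, R, S} \<subseteq> U"
  shows "S = R \<or> S = P + Q - R"
proof (rule equilateral_triangle_third_vertex_affine_hull[OF PQR PQS])
  have hull: "affine hull {P, Q, R} \<subseteq> U"
    using U by (intro hull_minimal) auto
  have "aff_dim {P, Q, R} > 1"
    using PQR by (simp add: equilateral_triangle_def collinear_aff_dim)
  moreover have "aff_dim {P, Q, R} \<le> 2"
    using aff_dim_subset[of "{P, Q, R}" U] U by simp
  ultimately have "affine hull {P, Q, R} = U"
    using U hull by (intro affine_dim_equal) auto
  then show "S \<in> affine hull {P, Q, R}"
    using U by simp
qed

lemma zero_sum_plane_eq_hyperplane: "zero_sum_plane = {x. 1 \<bullet> x = 0}"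
  by (simp add: zero_sum_plane_def inner_vec_def sum_3)

lemma affine_zero_sum_plane: "affine zero_sum_plane"
  unfolding zero_sum_plane_eq_hyperplane by (rule affine_hyperplane)

lemma aff_dim_zero_sum_plane: "aff_dim zero_sum_plane = 2"
  unfolding zero_sum_plane_eq_hyperplane by (simp add: aff_dim_hyperplane)

definition zero_sum_rotation :: "real ^ 3 \<Rightarrow> real ^ 3" where
  "zero_sum_rotation P = vector [- P $ 3, - P $ 1, - P $ 2]"

lemma zero_sum_rotation_in_zero_sum_plane:
  "P \<in> zero_sum_plane \<Longrightarrow> zero_sum_rotation P \<in> zero_sum_plane"
  by (simp add: zero_sum_plane_def zero_sum_rotation_def)

lemma norm_zero_sum_rotation: "norm (zero_sum_rotation P) = norm P"
  by (simp add: zero_sum_rotation_def norm_vec_def L2_set_def sum_3 add_ac)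

lemma zero_sum_rotation_diff:
  assumes "P \<in> zero_sum_plane"
  shows "zero_sum_rotation (P - zero_sum_rotation P) = P"
  using assms by (simp add: zero_sum_plane_def zero_sum_rotation_def vec_eq_iff forall_3)

lemma equilateral_triangle_zero_sum_rotation:
  assumes "P \<in> zero_sum_plane" and "P \<noteq> 0"
  shows "equilateral_triangle 0 P (zero_sum_rotation P)"
proof -
  have "norm (P - zero_sum_rotation P) = norm P"
    using norm_zero_sum_rotation[of "P - zero_sum_rotation P"] zero_sum_rotation_diff[OF assms(1)]
    by simp
  then show ?thesis
    using assms(2) by (simp add: equilateral_triangle_iff_dist dist_norm norm_zero_sum_rotation)
qed

lemma equilateral_triangle_zero_sum_plane_cases:
  assumes AB: "equilateral_triangle 0 A B" and plane: "A \<in> zero_sum_plane" "B \<in> zero_sum_plane"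
  obtains "B = zero_sum_rotation A" | "A = zero_sum_rotation B"
proof -
  have "A \<noteq> 0"
    using AB by (auto simp: equilateral_triangle_iff_dist)
  have "0 \<in> zero_sum_plane"
    by (simp add: zero_sum_plane_def)
  then have "B = zero_sum_rotation A \<or> B = 0 + A - zero_sum_rotation A"
    using plane AB equilateral_triangle_zero_sum_rotation[OF plane(1) \<open>A \<noteq> 0\<close>]
      zero_sum_rotation_in_zero_sum_plane affine_zero_sum_plane aff_dim_zero_sum_plane
    by (intro equilateral_triangle_third_vertex) auto
  then show ?thesis
    using that zero_sum_rotation_diff[OF plane(1)] by auto
qed

lemma integer_point_zero_sum_planeE:
  assumes "P \<in> integer_points" and "P \<in> zero_sum_plane"
  obtains m n :: int where "P = vector [of_int m, of_int (- n), of_int (n - m)]"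
proof -
  obtain a b where "P $ 1 = of_int a" and "P $ 2 = of_int b"
    using assms(1) unfolding integer_points_def by (metis Ints_cases mem_Collect_eq)
  then have "P = vector [of_int a, of_int (- (- b)), of_int (- b - a)]"
    using assms(2) by (simp add: zero_sum_plane_def vec_eq_iff forall_3)
  then show ?thesis
    by (rule that)
qed

lemma zero_sum_rotation_vector:
  "zero_sum_rotation (vector [x, - y, y - x]) = vector [x - y, - x, y]"
  by (simp add: zero_sum_rotation_def)

lemma norm_zero_sum_vector:
  "norm (vector [x, - y, y - x] :: real ^ 3) = sqrt (2 * (x\<^sup>2 - x * y + y\<^sup>2))"
  by (simp add: norm_vec_def L2_set_def sum_3 power2_eq_square algebra_simps)

theorem theorem4p2:
  fixes A B :: "real ^ 3"
  assumes "A \<in> integer_points" and "B \<in> integer_points"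
    and "equilateral_triangle 0 A B"
    and "{0, A, B} \<subseteq> zero_sum_plane"
  shows "\<exists>m n :: int.
    {A, B} = {vector [of_int m, of_int (- n), of_int (n - m)],
              vector [of_int (m - n), of_int (- m), of_int n]} \<and>
    dist 0 A = sqrt (of_int (2 * (m\<^sup>2 - m * n + n\<^sup>2))) \<and>
    dist A B = sqrt (of_int (2 * (m\<^sup>2 - m * n + n\<^sup>2))) \<and>
    dist B 0 = sqrt (of_int (2 * (m\<^sup>2 - m * n + n\<^sup>2)))"
proof -
  have plane: "A \<in> zero_sum_plane" "B \<in> zero_sum_plane"
    using assms(4) by auto
  obtain P where P: "P \<in> {A, B}" and AB: "{A, B} = {P, zero_sum_rotation P}"
    using equilateral_triangle_zero_sum_plane_cases[OF assms(3) plane] by blast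
  obtain m n :: int where P_eq: "P = vector [of_int m, of_int (- n), of_int (n - m)]"
    using integer_point_zero_sum_planeE P assms(1,2) plane by blast
  have "zero_sum_rotation P = vector [of_int (m - n), of_int (- m), of_int n]"
    by (simp add: P_eq zero_sum_rotation_vector)
  moreover have "norm P = sqrt (of_int (2 * (m\<^sup>2 - m * n + n\<^sup>2)))"
    by (simp add: P_eq norm_zero_sum_vector)
  moreover have "dist 0 A = norm P" "dist A B = norm P" "dist B 0 = norm P"
    using assms(3) P by (auto simp: equilateral_triangle_def)
  ultimately show ?thesis
    using AB P_eq by metis
qed

end
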